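(* Let $\alpha=4$ and let $f_\varepsilon:\mathbb{R}^2\times\mathbb{T}^2\to\mathbb{R}^2\times\mathbb{T}^2$ be the generalized standard map $$f_\varepsilon(x,y,\theta,I)=\begin{pmatrix}x+y+\alpha\sin x\\ y+\alpha\sin x\\ \theta+I\\ I\end{pmatrix}+\varepsilon\begin{pmatrix}\cos x\,\sin\theta\\ \cos x\,\sin\theta\\ \sin x\,\cos\theta\\ \sin x\,\cos\theta\end{pmatrix}.$$ There exists $M>0$ such that for every finite sequence $\{I_l\}_{l=0}^L\subset\left[\frac15,\pi-\frac1{10}\right]$ and for every sufficiently small $\varepsilon>0$ there exist a sequence of integers $n_1^\varepsilon,\ldots,n_L^\varepsilon$, a point $z_0^\varepsilon$, and a sequence of points $z_l^\varepsilon:=f_\varepsilon^{n_l^\varepsilon}(z_{l-1}^\varepsilon)$ for $l=1,\ldots,L$, such that $$|\pi_I z_l^\varepsilon-I_l|<\varepsilon M\qquad\text{for } l=0,\ldots,L.$$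
   Context: $\mathbb{T}=\mathbb{R}\bmod 2\pi$; $(x,y)\in\mathbb{R}^2$, $(\theta,I)\in\mathbb{T}^2$ (the last two components of $f_\varepsilon$ are taken mod $2\pi$); $\pi_I(x,y,\theta,I)=I$. The interval $[\frac15,\pi-\frac1{10}]$ is regarded as a subset of $[0,2\pi)\simeq\mathbb{T}$ and $|\cdot|$ of a difference of elements of $\mathbb{T}$ is the distance in $\mathbb{T}$. *)

theory Defs
  imports "HOL-Analysis.Analysis" "HOL-Library.Real_Mod"
begin

quotient_type circle = real / "\<lambda>s t. [s = t] (rmod (2 * pi))"
  morphisms rep_circle to_circle
  by (rule equivpI) (auto intro!: reflpI sympI transpI simp: rcong_def)

instantiation circle :: ab_group_add
begin

lift_definition zero_circle :: circle is "0 :: real" .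

lift_definition plus_circle :: "circle \<Rightarrow> circle \<Rightarrow> circle" is "(+) :: real \<Rightarrow> real \<Rightarrow> real"
  by (rule rcong_add)

lift_definition minus_circle :: "circle \<Rightarrow> circle \<Rightarrow> circle" is "(-) :: real \<Rightarrow> real \<Rightarrow> real"
  by (rule rcong_diff)

lift_definition uminus_circle :: "circle \<Rightarrow> circle" is "uminus :: real \<Rightarrow> real"
  by (rule rcong_uminus)

instance
  by standard (transfer, simp add: rcong_def algebra_simps)+

end

lift_definition circle_sin :: "circle \<Rightarrow> real" is "sin :: real \<Rightarrow> real"
  by (rule sin_rcong)

lift_definition circle_cos :: "circle \<Rightarrow> real" is "cos :: real \<Rightarrow> real"
  by (rule cos_rcong)

text \<open>The distance to zero in the quotient metric; the distance of \<open>a\<close> and \<open>b\<close> is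
  \<open>circle_abs (a - b)\<close>.\<close>

lift_definition circle_abs :: "circle \<Rightarrow> real" is "\<lambda>t. INF k::int. \<bar>t + 2 * pi * of_int k\<bar>"
proof -
  fix s t :: real
  assume "[s = t] (rmod (2 * pi))"
  then obtain n :: int where t: "t = s + of_int n * (2 * pi)"
    unfolding rcong_altdef by auto
  have "(INF k::int. \<bar>t + 2 * pi * of_int k\<bar>) =
        (INF k\<in>range (\<lambda>k. n + k). \<bar>s + 2 * pi * of_int k\<bar>)"
    unfolding t image_image by (simp add: algebra_simps)
  also have "range (\<lambda>k. n + k) = UNIV"
    by (rule surj_plus)
  finally show "(INF k::int. \<bar>s + 2 * pi * of_int k\<bar>) = (INF k::int. \<bar>t + 2 * pi * of_int k\<bar>)"
    by simp
qed

lemma circle_abs_to_circle: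
  assumes "\<bar>t\<bar> \<le> pi"
  shows "circle_abs (to_circle t) = \<bar>t\<bar>"
proof -
  have "\<bar>t\<bar> \<le> \<bar>t + 2 * pi * of_int k\<bar>" for k :: int
  proof (cases "k = 0")
    case False
    then have "1 \<le> \<bar>of_int k :: real\<bar>"
      by linarith
    then have "2 * pi * 1 \<le> 2 * pi * \<bar>of_int k\<bar>"
      by (intro mult_left_mono) auto
    then have "2 * pi \<le> \<bar>2 * pi * of_int k\<bar>"
      by (simp add: abs_mult)
    with assms show ?thesis
      by linarith
  qed simp
  then have "(INF k::int. \<bar>t + 2 * pi * of_int k\<bar>) = \<bar>t\<bar>"
    by (intro cInf_eq_minimum) (auto intro: image_eqI[of _ _ 0])
  then show ?thesis
    by (simp add: circle_abs.abs_eq)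
qed


type_synonym phase = "real \<times> real \<times> circle \<times> circle"

fun gen_std_map :: "real \<Rightarrow> real \<Rightarrow> phase \<Rightarrow> phase" where
  "gen_std_map \<alpha> \<epsilon> (x, y, \<theta>, I) =
    (x + y + \<alpha> * sin x + \<epsilon> * (cos x * circle_sin \<theta>),
     y + \<alpha> * sin x + \<epsilon> * (cos x * circle_sin \<theta>),
     \<theta> + I + to_circle (\<epsilon> * (sin x * circle_cos \<theta>)),
     I + to_circle (\<epsilon> * (sin x * circle_cos \<theta>)))"

fun action :: "phase \<Rightarrow> circle" where
  "action (x, y, \<theta>, I) = I"

text \<open>Negative iterates are meaningful for bijections only.\<close>

definition int_iterate :: "('a \<Rightarrow> 'a) \<Rightarrow> int \<Rightarrow> 'a \<Rightarrow> 'a" where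
  "int_iterate f n = (if 0 \<le> n then f ^^ nat n else inv f ^^ nat (- n))"

lemma bij_gen_std_map: "bij (gen_std_map \<alpha> \<epsilon>)"
proof (rule o_bij)
  define g where "g = (\<lambda>(x, y, \<theta>, I).
    let x' = x - y; \<theta>' = \<theta> - I in
    (x', y - \<alpha> * sin x' - \<epsilon> * (cos x' * circle_sin \<theta>'),
     \<theta>', I - to_circle (\<epsilon> * (sin x' * circle_cos \<theta>'))))"
  show "g \<circ> gen_std_map \<alpha> \<epsilon> = id" "gen_std_map \<alpha> \<epsilon> \<circ> g = id"
    by (auto simp: fun_eq_iff g_def Let_def)
qed

end

theory Submission
  imports Defs
begin

text \<open>Along an orbit let \<open>x\<close> and \<open>\<theta>\<close> be lifted to the reals. The map is then a second-order recursion,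
  \<open>x'' - 2 x' + x = 4 sin x' + \<epsilon> cos x' sin \<theta>'\<close> for three consecutive positions \<open>x\<close>, \<open>x'\<close>, \<open>x''\<close>,
  while each step adds \<open>\<epsilon> sin x cos \<theta>\<close> to the action. Since the force has period \<open>2 \<pi>\<close>, only residues of
  the positions matter, and their recursion holds up to a multiple \<open>2 \<pi> k\<close> with an integer \<open>k\<close>
  that may be chosen freely at every step (\<open>lift_step\<close>, \<open>lifts_to_step\<close>). Choosing \<open>k = 0\<close> keeps the residue
  near the saddle \<open>x = 0\<close>; a single \<open>k = \<plusminus> 1\<close>, a kick, makes the orbit leave the saddle and return to it
  modulo \<open>2 \<pi>\<close>, with a residue near \<open>\<plusminus> 1.4\<close> at the time of the kick.

  All these residues lie where \<open>cos x \<ge> 1/10\<close>. There the response \<open>2 x + 4 sin x\<close> has slope at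
  least \<open>12/5 > 2\<close>, so the recursion is uniformly hyperbolic with one expanding direction. A curve of states
  along that direction which crosses the current window crosses, after one step, the next window
  (\<open>unstable_arc_step\<close>, by the intermediate value theorem), and all other coordinates stay Lipschitz functions
  of the position on it, with constants of order \<open>\<epsilon>\<close> for the angle and the action. All points of the curve thus
  agree in angle and action up to \<open>O(\<epsilon>)\<close>, so the time and the sign of the next kick can be decided from any
  one of them. This replaces the choice of an orbit: the curve is followed, cut to the window at each step,
  and an orbit is read off backwards at the end.

  It remains to steer. Within 22 steps there is a time at which \<open>\<bar>cos \<theta>\<bar> \<ge> 1/2\<close>
  (\<open>favourable_phase\<close>; here the action must stay away from \<open>0\<close> and \<open>\<pi>\<close>). A kick at that time, with the right sign,
  changes the action by at least \<open>\<epsilon>/50\<close> in the desired direction over a block of 24 steps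
  (\<open>kick_gain\<close>, \<open>kick_block\<close>). As a block changes the action by at most \<open>24 \<epsilon>\<close>, repeated blocks bring
  it within \<open>30 \<epsilon>\<close> of any value in \<open>[1/5, \<pi> - 1/10]\<close> (\<open>transport_to_action\<close>), and this is
  iterated along the given sequence.\<close>

section \<open>Numerical bounds for sine and cosine\<close>

lemma sin_cubic_bound: "\<bar>x - sin x\<bar> \<le> \<bar>x\<bar> ^ 3 / 6" for x :: real
proof -
  have "\<bar>sin x - (\<Sum>m<3. sin_coeff m * x ^ m)\<bar> \<le> inverse (fact 3) * \<bar>x\<bar> ^ 3"
    by (rule Maclaurin_sin_bound)
  moreover have "(\<Sum>m<3. sin_coeff m * x ^ m) = x"
    by (simp add: sin_coeff_def eval_nat_numeral)
  moreover have "inverse (fact 3) * \<bar>x\<bar> ^ 3 = \<bar>x\<bar> ^ 3 / 6"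
    by (simp add: fact_numeral)
  ultimately show ?thesis
    by (simp only: abs_minus_commute)
qed

lemma sin_lipschitz: "\<bar>sin u - sin v\<bar> \<le> \<bar>u - v\<bar>" for u v :: real
proof -
  have "\<bar>sin u - sin v\<bar> = 2 * (\<bar>sin ((u - v) / 2)\<bar> * \<bar>cos ((u + v) / 2)\<bar>)"
    by (simp add: sin_diff_sin abs_mult)
  also have "\<dots> \<le> 2 * (\<bar>(u - v) / 2\<bar> * 1)"
    by (intro mult_left_mono mult_mono abs_sin_x_le_abs_x) auto
  finally show ?thesis by simp
qed

lemma cos_lipschitz: "\<bar>cos u - cos v\<bar> \<le> \<bar>u - v\<bar>" for u v :: real
  using sin_lipschitz[of "pi/2 - u" "pi/2 - v"] by (simp add: sin_diff abs_minus_commute)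

lemma product_lipschitz:
  fixes f g :: "real \<Rightarrow> real"
  assumes "\<bar>f u - f v\<bar> \<le> \<bar>u - v\<bar>" "\<bar>g s - g t\<bar> \<le> \<bar>s - t\<bar>" "\<bar>f v\<bar> \<le> 1" "\<bar>g s\<bar> \<le> 1"
  shows "\<bar>f u * g s - f v * g t\<bar> \<le> \<bar>u - v\<bar> + \<bar>s - t\<bar>"
proof -
  have "f u * g s - f v * g t = (f u - f v) * g s + f v * (g s - g t)"
    by (simp add: algebra_simps)
  also have "\<bar>\<dots>\<bar> \<le> \<bar>f u - f v\<bar> * \<bar>g s\<bar> + \<bar>f v\<bar> * \<bar>g s - g t\<bar>"
    by (metis abs_mult abs_triangle_ineq)
  also have "\<dots> \<le> \<bar>u - v\<bar> * 1 + 1 * \<bar>s - t\<bar>"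
    using assms by (intro add_mono mult_mono) auto
  finally show ?thesis by simp
qed

text \<open>Bounds for the residue at steps without and with a kick. The pair must satisfy
  \<open>2 s + 4 sin s > s + w\<close> and \<open>2 w + 4 sin w > 2 \<pi> + 2 s\<close>, which makes
  the response of a window exceed what its two neighbours and the kick ask for when a large window stands between small
  ones; and \<open>cos w\<close> must be bounded away from \<open>0\<close> for hyperbolicity. The admissible range is narrow, whence the particular values.\<close>

abbreviation (input) small_window :: real where "small_window \<equiv> 61/200"
abbreviation (input) large_window :: real where "large_window \<equiv> 147/100"

lemma pi_half_minus_large_window: "10079/100000 \<le> pi/2 - large_window" "pi/2 - large_window \<le> 1008/10000"
  using pi_approx by simp_all

lemma cos_large_window: "1/10 \<le> cos large_window"
proof -
  let ?x = "pi/2 - large_window"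
  have "\<bar>?x\<bar>^3 \<le> (1008/10000)^3"
    using pi_half_minus_large_window by (intro power_mono) auto
  also have "(1008/10000)^3 \<le> (11/10000::real)"
    by (simp add: eval_nat_numeral)
  finally have "\<bar>?x\<bar>^3 \<le> 11/10000" .
  then have "1/10 \<le> sin ?x"
    using sin_cubic_bound[of ?x] pi_half_minus_large_window by linarith
  then show ?thesis by (simp add: sin_diff)
qed

lemma cos_quadratic_bound: "1 - x\<^sup>2 / 2 \<le> cos x" for x :: real
proof -
  have "(sin (x/2))\<^sup>2 \<le> (x/2)\<^sup>2"
    using abs_sin_x_le_abs_x[of "x/2"] unfolding abs_le_square_iff .
  moreover have "cos x = 1 - 2 * (sin (x/2))\<^sup>2"
    using cos_double_sin[of "x/2"] by simp
  ultimately show ?thesis by (simp add: power_divide)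
qed

lemma sin_large_window: "994/1000 \<le> sin large_window"
proof -
  let ?x = "pi/2 - large_window"
  have "?x^2 \<le> (1008/10000)^2"
    using pi_half_minus_large_window by (intro power_mono) auto
  also have "(1008/10000)^2 \<le> (11/1000::real)"
    by (simp add: eval_nat_numeral)
  finally have "?x^2 \<le> 11/1000" .
  then have "994/1000 \<le> cos ?x"
    using cos_quadratic_bound[of ?x] by linarith
  then show ?thesis by (simp add: cos_diff)
qed

lemma sin_small_window: "3/10 \<le> sin small_window"
proof -
  have "\<bar>small_window\<bar>^3 / 6 \<le> 5/1000"
    by (simp add: eval_nat_numeral)
  then show ?thesis
    using sin_cubic_bound[of small_window] by linarith
qed

text \<open>The source of hyperbolicity: differences of the positions obey \<open>D'' \<approx> g D' - D\<close> with slope \<open>g \<ge> 12/5\<close>, and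
  if \<open>\<bar>D\<bar> \<le> 2/3 \<bar>D'\<bar>\<close> then \<open>\<bar>D''\<bar> \<ge> (12/5 - 2/3) \<bar>D'\<bar> > 3/2 \<bar>D'\<bar>\<close>, which leaves room for the perturbation.\<close>

lemma kick_response_expanding:
  assumes "\<bar>u\<bar> \<le> large_window" "\<bar>v\<bar> \<le> large_window"
  shows "12/5 * \<bar>u - v\<bar> \<le> \<bar>(2 * u + 4 * sin u) - (2 * v + 4 * sin v)\<bar>"
proof -
  have *: "12/5 * (v - u) \<le> (2 * v + 4 * sin v) - (2 * u + 4 * sin u)"
    if "u < v" "\<bar>u\<bar> \<le> large_window" "\<bar>v\<bar> \<le> large_window" for u v :: real
  proof -
    have "\<exists>w. u < w \<and> w < v \<and> sin v - sin u = (v - u) * cos w"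
      using \<open>u < v\<close> by (intro MVT2) (auto intro: DERIV_sin)
    then obtain w where w: "u < w" "w < v" "sin v - sin u = (v - u) * cos w" by blast
    have "cos large_window \<le> cos \<bar>w\<bar>"
      using that w pi_gt3 by (intro cos_monotone_0_pi_le) auto
    then have "1/10 \<le> cos w"
      using cos_large_window by simp
    then have "(v - u) * (1/10) \<le> (v - u) * cos w"
      using \<open>u < v\<close> by (intro mult_left_mono) auto
    then have "(v - u) * (1/10) \<le> sin v - sin u" using w by simp
    then show ?thesis by (simp add: field_simps)
  qed
  show ?thesis
    using *[of u v] *[of v u] assms by (cases u v rule: linorder_cases) auto
qed

section \<open>Lifting the map to a recursion with free integer controls\<close>

text \<open>The residue \<open>pos\<close> and its predecessor \<open>prev\<close> encode position and momentum: the momentum is \<open>pos - prev\<close>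
  up to a multiple of \<open>2 \<pi>\<close>.\<close>

datatype lift = Lift (prev: real) (pos: real) (angle: real) (act: real)

definition lift_step :: "real \<Rightarrow> int \<Rightarrow> lift \<Rightarrow> lift" where
  "lift_step \<epsilon> k S = Lift
     (pos S)
     (2 * pos S - prev S + 4 * sin (pos S) - 2 * pi * of_int k
       + \<epsilon> * (cos (pos S) * sin (angle S)))
     (angle S + act S + \<epsilon> * (sin (pos S) * cos (angle S)))
     (act S + \<epsilon> * (sin (pos S) * cos (angle S)))"

lemma lift_step_simps [simp]:
  "prev (lift_step \<epsilon> k S) = pos S"
  "pos (lift_step \<epsilon> k S) = 2 * pos S - prev S + 4 * sin (pos S) - 2 * pi * of_int k
       + \<epsilon> * (cos (pos S) * sin (angle S))"
  "angle (lift_step \<epsilon> k S) = angle S + act S + \<epsilon> * (sin (pos S) * cos (angle S))"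
  "act (lift_step \<epsilon> k S) = act S + \<epsilon> * (sin (pos S) * cos (angle S))"
  by (simp_all add: lift_step_def)

definition lifts_to :: "phase \<Rightarrow> lift \<Rightarrow> bool" where
  "lifts_to z S \<longleftrightarrow> (\<exists>m k :: int. z =
     (pos S + 2 * pi * of_int m, pos S - prev S + 2 * pi * of_int k,
      to_circle (angle S), to_circle (act S)))"

lemma sin_shift: "sin (x + 2 * pi * of_int m) = sin x"
  using sin_int_2pin[of m] cos_int_2pin[of m] by (simp add: sin_add)
lemma cos_shift: "cos (x + 2 * pi * of_int m) = cos x"
  using sin_int_2pin[of m] cos_int_2pin[of m] by (simp add: cos_add)

text \<open>Every choice of the control \<open>k\<close> yields a lift of the image: it only alters the two
  integers by which the residues differ from the true position and momentum.\<close>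

lemma lifts_to_step:
  assumes "lifts_to z S"
  shows "lifts_to (gen_std_map 4 \<epsilon> z) (lift_step \<epsilon> k S)"
proof -
  obtain m l :: int where z: "z = (pos S + 2 * pi * of_int m, pos S - prev S + 2 * pi * of_int l,
      to_circle (angle S), to_circle (act S))"
    using assms by (auto simp: lifts_to_def)
  show ?thesis
    unfolding lifts_to_def z
    apply (rule exI[of _ "m + l + k"], rule exI[of _ "l + k"])
    apply (simp add: sin_shift cos_shift circle_sin.abs_eq circle_cos.abs_eq plus_circle.abs_eq)
    apply (simp add: algebra_simps)
    done
qed

section \<open>Arcs along the expanding direction\<close>

text \<open>An arc is a set of states that is a graph over the window \<open>\<bar>pos\<bar> \<le> r\<close>, tangent to an unstable cone.
  The ratio \<open>2/3\<close> comes from the expansion rate \<open>3/2\<close>; the constants \<open>3\<close> and \<open>9\<close>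
  are large enough to be reproduced by one step, which adds to the old
  slopes those of the perturbation (and, for the angle, of the action) and divides by \<open>3/2\<close>.\<close>

definition unstable_arc :: "real \<Rightarrow> real \<Rightarrow> real \<Rightarrow> lift set \<Rightarrow> bool" where
  "unstable_arc \<epsilon> q r \<Gamma> \<longleftrightarrow>
     (\<forall>b\<in>{-r..r}. \<exists>S\<in>\<Gamma>. pos S = b) \<and>
     (\<forall>S\<in>\<Gamma>. \<bar>prev S\<bar> \<le> q \<and> \<bar>pos S\<bar> \<le> r) \<and>
     (\<forall>S\<in>\<Gamma>. \<forall>T\<in>\<Gamma>. \<bar>prev S - prev T\<bar> \<le> 2/3 * \<bar>pos S - pos T\<bar> \<and>
        \<bar>angle S - angle T\<bar> \<le> 9 * \<epsilon> * \<bar>pos S - pos T\<bar> \<and>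
        \<bar>act S - act T\<bar> \<le> 3 * \<epsilon> * \<bar>pos S - pos T\<bar>)"

lemma cone_step:
  fixes k :: int
  assumes eps: "0 < \<epsilon>" "\<epsilon> \<le> 1/1000"
    and win: "\<bar>pos S\<bar> \<le> large_window" "\<bar>pos T\<bar> \<le> large_window"
    and cone: "\<bar>prev S - prev T\<bar> \<le> 2/3 * \<bar>pos S - pos T\<bar>"
        "\<bar>angle S - angle T\<bar> \<le> 9 * \<epsilon> * \<bar>pos S - pos T\<bar>"
        "\<bar>act S - act T\<bar> \<le> 3 * \<epsilon> * \<bar>pos S - pos T\<bar>"
  defines "S' \<equiv> lift_step \<epsilon> k S" and "T' \<equiv> lift_step \<epsilon> k T"
  shows "\<bar>prev S' - prev T'\<bar> \<le> 2/3 * \<bar>pos S' - pos T'\<bar>"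
        "\<bar>angle S' - angle T'\<bar> \<le> 9 * \<epsilon> * \<bar>pos S' - pos T'\<bar>"
        "\<bar>act S' - act T'\<bar> \<le> 3 * \<epsilon> * \<bar>pos S' - pos T'\<bar>"
proof -
  define D where "D = \<bar>pos S - pos T\<bar>"
  have D0: "0 \<le> D" by (simp add: D_def)
  have ED0: "0 \<le> \<epsilon> * D" using eps D0 by simp
  have ED: "\<epsilon> * D \<le> D / 1000" using mult_right_mono[OF eps(2) D0] by simp
  have force: "\<bar>\<epsilon> * (f (pos S) * g (angle S)) - \<epsilon> * (f (pos T) * g (angle T))\<bar> \<le> 11/10 * (\<epsilon> * D)"
    if "\<bar>f (pos S) - f (pos T)\<bar> \<le> \<bar>pos S - pos T\<bar>" "\<bar>g (angle S) - g (angle T)\<bar> \<le> \<bar>angle S - angle T\<bar>"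
       "\<bar>f (pos T)\<bar> \<le> 1" "\<bar>g (angle S)\<bar> \<le> 1" for f g :: "real \<Rightarrow> real"
  proof -
    have "\<bar>f (pos S) * g (angle S) - f (pos T) * g (angle T)\<bar> \<le> D + 9 * (\<epsilon> * D)"
      using product_lipschitz[of f "pos S" "pos T" g "angle S" "angle T"] that cone(2)
      by (simp add: D_def)
    also have "\<dots> \<le> 11/10 * D" using ED D0 by simp
    finally have "\<epsilon> * \<bar>f (pos S) * g (angle S) - f (pos T) * g (angle T)\<bar> \<le> \<epsilon> * (11/10 * D)"
      using eps by (intro mult_left_mono) auto
    then show ?thesis using eps by (simp add: abs_mult flip: right_diff_distrib)
  qed
  have f1: "\<bar>\<epsilon> * (cos (pos S) * sin (angle S)) - \<epsilon> * (cos (pos T) * sin (angle T))\<bar> \<le> 11/10 * (\<epsilon> * D)"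
    by (intro force sin_lipschitz cos_lipschitz) auto
  have f2: "\<bar>\<epsilon> * (sin (pos S) * cos (angle S)) - \<epsilon> * (sin (pos T) * cos (angle T))\<bar> \<le> 11/10 * (\<epsilon> * D)"
    by (intro force sin_lipschitz cos_lipschitz) auto
  have "12/5 * D \<le> \<bar>(2 * pos S + 4 * sin (pos S)) - (2 * pos T + 4 * sin (pos T))\<bar>"
    using win unfolding D_def by (rule kick_response_expanding)
  then have expand: "3/2 * D \<le> \<bar>pos S' - pos T'\<bar>"
    using f1 cone(1) ED D0 unfolding S'_def T'_def lift_step_simps D_def[symmetric] by linarith
  then have "\<epsilon> * (3/2 * D) \<le> \<epsilon> * \<bar>pos S' - pos T'\<bar>"
    using eps by (intro mult_left_mono) auto
  then have expand': "3/2 * (\<epsilon> * D) \<le> \<epsilon> * \<bar>pos S' - pos T'\<bar>"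
    by (simp only: mult.left_commute[of \<epsilon> "3/2" D])
  show "\<bar>prev S' - prev T'\<bar> \<le> 2/3 * \<bar>pos S' - pos T'\<bar>"
    using expand by (simp add: S'_def T'_def D_def)
  have c2: "\<bar>angle S - angle T\<bar> \<le> 9 * (\<epsilon> * D)" and c3: "\<bar>act S - act T\<bar> \<le> 3 * (\<epsilon> * D)"
    using cone by (simp_all add: D_def)
  have "\<bar>act S' - act T'\<bar> \<le> 3 * (\<epsilon> * D) + 11/10 * (\<epsilon> * D)"
    using f2 c3 unfolding S'_def T'_def lift_step_simps by linarith
  then show "\<bar>act S' - act T'\<bar> \<le> 3 * \<epsilon> * \<bar>pos S' - pos T'\<bar>"
    using expand' ED0 unfolding mult.assoc by linarith
  have "\<bar>angle S' - angle T'\<bar> \<le> 12 * (\<epsilon> * D) + 11/10 * (\<epsilon> * D)"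
    using f2 c2 c3 unfolding S'_def T'_def lift_step_simps by linarith
  then show "\<bar>angle S' - angle T'\<bar> \<le> 9 * \<epsilon> * \<bar>pos S' - pos T'\<bar>"
    using expand' ED0 unfolding mult.assoc by linarith
qed

text \<open>At the two ends \<open>pos = \<plusminus> r\<close> of the arc, the covering hypothesis places the next position beyond \<open>r'\<close>
  on either side, whatever the sign of the kick; continuity fills the window in between, and the cone condition is
  inherited by \<open>cone_step\<close>.\<close>

lemma unstable_arc_step:
  assumes eps: "0 < \<epsilon>" "\<epsilon> \<le> 1/1000"
    and arc: "unstable_arc \<epsilon> q r \<Gamma>" and r: "0 \<le> r" "r \<le> large_window"
    and cover: "q + r' + 2 * pi * \<bar>of_int k\<bar> + \<epsilon> \<le> 2 * r + 4 * sin r"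
  shows "unstable_arc \<epsilon> r r' {T \<in> lift_step \<epsilon> k ` \<Gamma>. \<bar>pos T\<bar> \<le> r'}"
proof -
  have sur: "\<And>b. b \<in> {-r..r} \<Longrightarrow> \<exists>S\<in>\<Gamma>. pos S = b"
    and win: "\<And>S. S \<in> \<Gamma> \<Longrightarrow> \<bar>prev S\<bar> \<le> q \<and> \<bar>pos S\<bar> \<le> r"
    and lip: "\<And>S T. S \<in> \<Gamma> \<Longrightarrow> T \<in> \<Gamma> \<Longrightarrow> \<bar>prev S - prev T\<bar> \<le> 2/3 * \<bar>pos S - pos T\<bar> \<and>
        \<bar>angle S - angle T\<bar> \<le> 9 * \<epsilon> * \<bar>pos S - pos T\<bar> \<and>
        \<bar>act S - act T\<bar> \<le> 3 * \<epsilon> * \<bar>pos S - pos T\<bar>"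
    using arc unfolding unstable_arc_def by blast+
  obtain c where c: "\<And>b. b \<in> {-r..r} \<Longrightarrow> c b \<in> \<Gamma> \<and> pos (c b) = b"
    using sur by metis
  have cont_prev: "continuous_on {-r..r} (\<lambda>b. prev (c b))"
    and cont_angle: "continuous_on {-r..r} (\<lambda>b. angle (c b))"
  proof -
    have "(2/3)-lipschitz_on {-r..r} (\<lambda>b. prev (c b))"
      by (rule lipschitz_onI) (use c lip in \<open>force simp: dist_real_def\<close>)+
    then show "continuous_on {-r..r} (\<lambda>b. prev (c b))" by (rule lipschitz_on_continuous_on)
    have "(9 * \<epsilon>)-lipschitz_on {-r..r} (\<lambda>b. angle (c b))"
      by (rule lipschitz_onI) (use c lip eps in \<open>force simp: dist_real_def\<close>)+
    then show "continuous_on {-r..r} (\<lambda>b. angle (c b))" by (rule lipschitz_on_continuous_on)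
  qed
  define h where "h = (\<lambda>b. 2 * b - prev (c b) + 4 * sin b - 2 * pi * of_int k
       + \<epsilon> * (cos b * sin (angle (c b))))"
  have h: "pos (lift_step \<epsilon> k (c b)) = h b" if "b \<in> {-r..r}" for b
    using c[OF that] by (simp add: h_def)
  have cont: "continuous_on {-r..r} h"
    unfolding h_def by (intro continuous_intros cont_prev cont_angle)
  have err: "\<bar>\<epsilon> * (cos b * sin (angle (c b)))\<bar> \<le> \<epsilon>" for b
  proof -
    have "\<bar>cos b\<bar> * \<bar>sin (angle (c b))\<bar> \<le> 1 * 1" by (intro mult_mono) auto
    then show ?thesis using eps mult_left_mono[of "\<bar>cos b\<bar> * \<bar>sin (angle (c b))\<bar>" 1 \<epsilon>] by (simp add: abs_mult)
  qed
  have "\<bar>2 * pi * of_int k :: real\<bar> = 2 * pi * \<bar>of_int k\<bar>" by (simp add: abs_mult)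
  then have kick: "2 * pi * of_int k \<le> 2 * pi * \<bar>of_int k\<bar>" "- (2 * pi * of_int k) \<le> 2 * pi * \<bar>of_int k\<bar>"
    by (metis abs_ge_self abs_ge_minus_self)+
  have "\<bar>prev (c r)\<bar> \<le> q" "\<bar>prev (c (-r))\<bar> \<le> q" using c win r by auto
  then have lo: "h (-r) \<le> -r'" and hi: "r' \<le> h r"
    using err[of r] err[of "-r"] cover kick unfolding h_def sin_minus by linarith+
  have "\<exists>T\<in>{T \<in> lift_step \<epsilon> k ` \<Gamma>. \<bar>pos T\<bar> \<le> r'}. pos T = b'" if b': "b' \<in> {-r'..r'}" for b'
  proof -
    obtain b where b: "-r \<le> b" "b \<le> r" "h b = b'"
      using IVT'[of h "-r" b' r] lo hi b' r cont by auto
    then have "pos (lift_step \<epsilon> k (c b)) = b'" using h by simp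
    moreover have "c b \<in> \<Gamma>" using c b by simp
    ultimately show ?thesis using b' by (intro bexI[of _ "lift_step \<epsilon> k (c b)"]) auto
  qed
  moreover have "\<bar>prev (lift_step \<epsilon> k S)\<bar> \<le> r" if "S \<in> \<Gamma>" for S
    using win that by simp
  moreover have "\<bar>prev S' - prev T'\<bar> \<le> 2/3 * \<bar>pos S' - pos T'\<bar> \<and>
        \<bar>angle S' - angle T'\<bar> \<le> 9 * \<epsilon> * \<bar>pos S' - pos T'\<bar> \<and>
        \<bar>act S' - act T'\<bar> \<le> 3 * \<epsilon> * \<bar>pos S' - pos T'\<bar>"
    if "S' \<in> lift_step \<epsilon> k ` \<Gamma>" "T' \<in> lift_step \<epsilon> k ` \<Gamma>" for S' T'
  proof -
    obtain S T where "S \<in> \<Gamma>" "T \<in> \<Gamma>" "S' = lift_step \<epsilon> k S" "T' = lift_step \<epsilon> k T"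
      using \<open>S' \<in> _\<close> \<open>T' \<in> _\<close> by blast
    moreover have "\<bar>pos S\<bar> \<le> large_window" "\<bar>pos T\<bar> \<le> large_window"
      using win \<open>S \<in> \<Gamma>\<close> \<open>T \<in> \<Gamma>\<close> r by fastforce+
    ultimately show ?thesis
      using cone_step[OF eps, of S T] lip by metis
  qed
  ultimately show ?thesis
    unfolding unstable_arc_def by auto
qed

section \<open>Arcs that follow a schedule of kicks\<close>

primrec trajectory :: "real \<Rightarrow> (nat \<Rightarrow> int) \<Rightarrow> lift \<Rightarrow> nat \<Rightarrow> lift" where
  "trajectory \<epsilon> \<sigma> S 0 = S"
| "trajectory \<epsilon> \<sigma> S (Suc n) = lift_step \<epsilon> (\<sigma> n) (trajectory \<epsilon> \<sigma> S n)"

text \<open>Endpoints of the trajectories that stay within the windows \<open>r\<close>. Recording endpoints rather than initial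
  states makes this set the image arc, so that the step lemma applies to it directly.\<close>

definition survivors :: "real \<Rightarrow> (nat \<Rightarrow> int) \<Rightarrow> (nat \<Rightarrow> real) \<Rightarrow> lift set \<Rightarrow> nat \<Rightarrow> lift set" where
  "survivors \<epsilon> \<sigma> r \<Gamma> n =
     (\<lambda>S. trajectory \<epsilon> \<sigma> S n) ` {S \<in> \<Gamma>. \<forall>i\<le>n. \<bar>pos (trajectory \<epsilon> \<sigma> S i)\<bar> \<le> r i}"

lemma survivors_Suc:
  "survivors \<epsilon> \<sigma> r \<Gamma> (Suc n) =
     {T \<in> lift_step \<epsilon> (\<sigma> n) ` survivors \<epsilon> \<sigma> r \<Gamma> n. \<bar>pos T\<bar> \<le> r (Suc n)}"
  unfolding survivors_def by (auto simp: le_Suc_eq simp del: lift_step_simps)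

lemma unstable_arc_survivors:
  assumes eps: "0 < \<epsilon>" "\<epsilon> \<le> 1/1000"
    and arc: "unstable_arc \<epsilon> q (r 0) \<Gamma>"
    and r: "\<And>i. 0 \<le> r i" "\<And>i. r i \<le> large_window"
    and cover: "\<And>i. i < n \<Longrightarrow>
      (if i = 0 then q else r (i - 1)) + r (Suc i) + 2 * pi * \<bar>of_int (\<sigma> i)\<bar> + \<epsilon>
        \<le> 2 * r i + 4 * sin (r i)"
  shows "unstable_arc \<epsilon> (if n = 0 then q else r (n - 1)) (r n) (survivors \<epsilon> \<sigma> r \<Gamma> n)"
  using cover
proof (induction n)
  case 0
  have "{S \<in> \<Gamma>. \<forall>i\<le>0. \<bar>pos (trajectory \<epsilon> \<sigma> S i)\<bar> \<le> r i} = \<Gamma>"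
    using arc by (auto simp: unstable_arc_def)
  then show ?case
    using arc by (simp add: survivors_def)
next
  case (Suc n)
  have "unstable_arc \<epsilon> (r n) (r (Suc n)) (survivors \<epsilon> \<sigma> r \<Gamma> (Suc n))"
    unfolding survivors_Suc
  proof (rule unstable_arc_step[OF eps])
    show "unstable_arc \<epsilon> (if n = 0 then q else r (n - 1)) (r n) (survivors \<epsilon> \<sigma> r \<Gamma> n)"
      using Suc by simp
    show "(if n = 0 then q else r (n - 1)) + r (Suc n) + 2 * pi * \<bar>of_int (\<sigma> n)\<bar> + \<epsilon>
        \<le> 2 * r n + 4 * sin (r n)"
      using Suc.prems[of n] by simp
  qed (use r in auto)
  then show ?case by simp
qed

text \<open>Over a bounded number of steps the angle advances as for the rigid rotation by the initial action, up to
  \<open>O(\<epsilon>)\<close>. This lets the gain of a block be computed with a linear phase.\<close>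

lemma trajectory_drift:
  fixes \<epsilon> :: real
  assumes "0 \<le> \<epsilon>"
  shows "\<bar>act (trajectory \<epsilon> \<sigma> S n) - act S\<bar> \<le> \<epsilon> * n"
    and "\<bar>angle (trajectory \<epsilon> \<sigma> S n) - (angle S + n * act S)\<bar> \<le> \<epsilon> * (real n)\<^sup>2"
proof -
  have force: "\<bar>\<epsilon> * (sin x * cos y)\<bar> \<le> \<epsilon>" for x y :: real
  proof -
    have "\<bar>sin x\<bar> * \<bar>cos y\<bar> \<le> 1 * 1" by (intro mult_mono) auto
    then show ?thesis using assms mult_left_mono[of "\<bar>sin x\<bar> * \<bar>cos y\<bar>" 1 \<epsilon>] by (simp add: abs_mult)
  qed
  have act: "\<bar>act (trajectory \<epsilon> \<sigma> S n) - act S\<bar> \<le> \<epsilon> * n" for n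
  proof (induction n)
    case (Suc n)
    then show ?case
      using force[of "pos (trajectory \<epsilon> \<sigma> S n)" "angle (trajectory \<epsilon> \<sigma> S n)"]
      by (simp add: distrib_left)
  qed simp
  show "\<bar>act (trajectory \<epsilon> \<sigma> S n) - act S\<bar> \<le> \<epsilon> * n" by (rule act)
  show "\<bar>angle (trajectory \<epsilon> \<sigma> S n) - (angle S + n * act S)\<bar> \<le> \<epsilon> * (real n)\<^sup>2"
  proof (induction n)
    case (Suc n)
    let ?T = "trajectory \<epsilon> \<sigma> S"
    have "angle (?T (Suc n)) - (angle S + Suc n * act S)
        = (angle (?T n) - (angle S + n * act S)) + (act (?T (Suc n)) - act S)"
      by (simp add: algebra_simps)
    also have "\<bar>\<dots>\<bar> \<le> \<epsilon> * (real n)\<^sup>2 + \<epsilon> * Suc n"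
      using Suc act[of "Suc n"] by linarith
    also have "\<dots> = \<epsilon> * ((real n)\<^sup>2 + Suc n)"
      by (simp add: distrib_left)
    also have "\<dots> \<le> \<epsilon> * (real (Suc n))\<^sup>2"
      using assms by (intro mult_left_mono) (auto simp: power2_eq_square algebra_simps)
    finally show ?case by simp
  qed simp
qed

lemma act_trajectory:
  "act (trajectory \<epsilon> \<sigma> S n) =
     act S + \<epsilon> * (\<Sum>i<n. sin (pos (trajectory \<epsilon> \<sigma> S i)) * cos (angle (trajectory \<epsilon> \<sigma> S i)))"
  by (induction n) (simp_all add: distrib_left)

section \<open>The change of action caused by one kick\<close>

text \<open>If \<open>\<bar>cos\<bar> < 1/2\<close> at all 22 times, then the cosines of the doubled angles are all below \<open>- 1/2\<close>, so their sum is
  below \<open>- 11\<close>; but \<open>2 sin I\<close> times that sum telescopes to a quantity of modulus at most \<open>2\<close>.\<close>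

lemma favourable_phase:
  fixes \<theta> I :: real
  assumes "1/11 \<le> sin I"
  shows "\<exists>k\<in>{1..22::nat}. 1/2 \<le> \<bar>cos (\<theta> + real k * I)\<bar>"
proof (rule ccontr)
  assume no: "\<not> ?thesis"
  have small: "cos (2 * \<theta> + 2 * real (Suc j) * I) < - 1/2" if "j < 22" for j :: nat
  proof -
    let ?c = "cos (\<theta> + Suc j * I)"
    have "Suc j \<in> {1..22}" using that by simp
    then have "\<bar>?c\<bar> < 1/2" using no by (meson not_le)
    then have "\<bar>?c\<bar>\<^sup>2 < (1/2)\<^sup>2" by (intro power_strict_mono) auto
    then have "?c\<^sup>2 < 1/4" by (simp add: power_divide)
    moreover have "cos (2 * \<theta> + 2 * real (Suc j) * I) = 2 * ?c\<^sup>2 - 1"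
      using cos_double_cos[of "\<theta> + Suc j * I"] by (simp only: distrib_left mult.assoc)
    ultimately show ?thesis by simp
  qed
  have tele: "2 * sin I * (\<Sum>j<n. cos (2 * \<theta> + 2 * real (Suc j) * I))
      = sin (2 * \<theta> + (2 * real n + 1) * I) - sin (2 * \<theta> + I)" for n :: nat
  proof (induction n)
    case (Suc n)
    have "2 * sin I * cos (2 * \<theta> + 2 * real (Suc n) * I)
      = sin ((2 * \<theta> + 2 * real (Suc n) * I) + I) - sin ((2 * \<theta> + 2 * real (Suc n) * I) - I)"
      by (simp add: sin_add sin_diff)
    then show ?case using Suc by (simp add: algebra_simps)
  qed simp
  have "(\<Sum>j<22. cos (2 * \<theta> + 2 * real (Suc j) * I)) < (\<Sum>j<(22::nat). - 1/2)"
    using small by (intro sum_strict_mono) (auto simp: lessThan_empty_iff)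
  then have "(\<Sum>j<22. cos (2 * \<theta> + 2 * real (Suc j) * I)) < - 11" by simp
  then have "2 * sin I * (\<Sum>j<22. cos (2 * \<theta> + 2 * real (Suc j) * I)) < 2 * sin I * (- 11)"
    using assms by (intro mult_strict_left_mono) auto
  also have "\<dots> \<le> - 2" using assms by simp
  finally have "sin (2 * \<theta> + 45 * I) - sin (2 * \<theta> + I) < - 2"
    unfolding tele by simp
  then show False
    using sin_ge_minus_one[of "2 * \<theta> + 45 * I"] sin_le_one[of "2 * \<theta> + I"] by linarith
qed

text \<open>The discrete Green identity: \<open>cos (\<phi> + j I)\<close> is an eigenvector of the operator that adds the
  two neighbours, with eigenvalue \<open>2 cos I\<close>.\<close>

lemma second_difference_by_parts:
  fixes u :: "nat \<Rightarrow> real"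
  shows "(\<Sum>j<N. (u (Suc (Suc j)) + u j) * cos (\<phi> + j * I))
     = 2 * cos I * (\<Sum>j<N. u (Suc j) * cos (\<phi> + j * I))
       + (u (Suc N) * cos (\<phi> + N * I - I) - u N * cos (\<phi> + N * I))
       - (u 1 * cos (\<phi> - I) - u 0 * cos \<phi>)"
proof (induction N)
  case (Suc N)
  define A where "A = \<phi> + N * I"
  have rec: "cos (A + I) = 2 * cos I * cos A - cos (A - I)"
    by (simp add: cos_add cos_diff)
  have phase: "\<phi> + Suc N * I = A + I" "\<phi> + Suc N * I - I = A"
    by (simp_all add: A_def algebra_simps)
  show ?case
    unfolding sum.lessThan_Suc Suc phase A_def[symmetric] rec
    by (simp add: distrib_left distrib_right right_diff_distrib mult_ac)
qed simp

lemma pi_bounds: "314/100 \<le> pi" "pi \<le> 315/100"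
  using pi_approx by simp_all

text \<open>The position one step before \<open>j\<close> is \<open>u j\<close>, so that \<open>u (Suc j)\<close> is the position at time \<open>j\<close>. Write \<open>c\<close> for the
  linear phases, \<open>X\<close> for the sum of \<open>sin u c\<close> and \<open>T\<close> for the sum of \<open>u c\<close>. Multiplying the recursion by \<open>c\<close> and summing by parts gives
  \<open>4 X + \<kappa> T = 2 \<pi> \<tau> c\<^sub>k + O(s) + O(\<epsilon>)\<close> with \<open>\<kappa> = 2 - 2 cos I \<in> [0, 4]\<close> and \<open>s\<close> the small window. Moreover
  \<open>T - X\<close> is the sum of \<open>(u - sin u) c\<close>, which is cubically small except at the kick. So \<open>(4 + \<kappa>) X\<close> is
  dominated by \<open>(2 \<pi> \<tau> - \<kappa> (u - sin u)) c\<^sub>k\<close> at time \<open>k\<close>, where \<open>\<bar>\<kappa> (u - sin u)\<bar> \<le> 2.12\<close> is well below \<open>2 \<pi>\<close>. In this way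
  the gain is controlled without any knowledge of the orbit beyond the windows.\<close>

lemma kick_gain:
  fixes u :: "nat \<Rightarrow> real" and \<epsilon> \<tau> d \<phi> I :: real
  assumes eps: "\<epsilon> \<le> 1/1000000"
    and ends: "\<bar>u 0\<bar> \<le> small_window" "\<bar>u 1\<bar> \<le> small_window"
      "\<bar>u 24\<bar> \<le> small_window" "\<bar>u (Suc 24)\<bar> \<le> small_window"
    and k: "k < 24"
    and small: "\<And>j. j < 24 \<Longrightarrow> j \<noteq> k \<Longrightarrow> \<bar>u (Suc j)\<bar> \<le> small_window"
    and large: "\<bar>u (Suc k)\<bar> \<le> large_window"
    and recurrence: "\<And>j. j < 24 \<Longrightarrow>
      \<bar>u (Suc (Suc j)) + u j - (2 * u (Suc j) + 4 * sin (u (Suc j)) - (if j = k then 2 * pi * \<tau> else 0))\<bar> \<le> \<epsilon>"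
    and units: "\<bar>d\<bar> = 1" "\<bar>\<tau>\<bar> = 1"
    and phase: "49/100 \<le> d * \<tau> * cos (\<phi> + k * I)"
  shows "1/25 \<le> d * (\<Sum>j<24. sin (u (Suc j)) * cos (\<phi> + j * I))"
proof -
  define c :: "nat \<Rightarrow> real" where "c = (\<lambda>j. cos (\<phi> + j * I))"
  define X where "X = (\<Sum>j<24. sin (u (Suc j)) * c j)"
  define T where "T = (\<Sum>j<24. u (Suc j) * c j)"
  define \<kappa> where "\<kappa> = 2 - 2 * cos I"
  define B where "B = (u (Suc 24) * cos (\<phi> + 24 * I - I) - u 24 * cos (\<phi> + 24 * I))
       - (u 1 * cos (\<phi> - I) - u 0 * cos \<phi>)"
  define R where "R = (\<Sum>j<24. (u (Suc (Suc j)) + u j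
      - (2 * u (Suc j) + 4 * sin (u (Suc j)) - (if j = k then 2 * pi * \<tau> else 0))) * c j)"
  define e where "e = (\<lambda>j. (u (Suc j) - sin (u (Suc j))))"
  define E where "E = (\<Sum>j\<in>{..<24}-{k}. e j * c j)"
  have bound: "\<bar>x * cos y\<bar> \<le> s" if "\<bar>x\<bar> \<le> s" for x y s :: real
    using mult_mono[OF that abs_cos_le_one[of y]] that by (simp add: abs_mult)

  \<comment> \<open>\<open>B\<close> collects the boundary terms, \<open>R\<close> the perturbation, \<open>e\<close> the nonlinear defects.\<close>
  have "(\<Sum>j<24. (u (Suc (Suc j)) + u j) * c j) = 2 * cos I * T + B"
    using second_difference_by_parts[where N = 24 and u = u and \<phi> = \<phi> and I = I]
    by (simp add: T_def B_def c_def)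
  moreover have "(\<Sum>j<24. (if j = k then 2 * pi * \<tau> else 0) * c j) = 2 * pi * \<tau> * c k"
    using k by (simp add: if_distrib[of "\<lambda>x. x * _"] cong: if_cong)
  moreover have "R = (\<Sum>j<24. (u (Suc (Suc j)) + u j) * c j) - 2 * T - 4 * X
      + (\<Sum>j<24. (if j = k then 2 * pi * \<tau> else 0) * c j)"
    unfolding R_def T_def X_def sum_distrib_left sum_subtractf[symmetric] sum.distrib[symmetric]
    by (rule sum.cong) (simp_all add: algebra_simps)
  moreover have "T = X + e k * c k + E"
  proof -
    have "T = X + (\<Sum>j<24. e j * c j)"
      unfolding T_def X_def e_def sum.distrib[symmetric]
      by (rule sum.cong) (simp_all add: algebra_simps)
    also have "(\<Sum>j<24. e j * c j) = e k * c k + E"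
      unfolding E_def using k by (intro sum.remove) auto
    finally show ?thesis by simp
  qed
  ultimately have "(4 + \<kappa>) * X = 2 * pi * \<tau> * c k + B - R - \<kappa> * (e k * c k) - \<kappa> * E"
    by (simp add: \<kappa>_def algebra_simps)
  then have "(4 + \<kappa>) * (d * X) = d * (2 * pi * \<tau> * c k + B - R - \<kappa> * (e k * c k) - \<kappa> * E)"
    by (metis mult.left_commute)
  then have id: "(4 + \<kappa>) * (d * X) = 2 * pi * (d * \<tau> * c k) + d * B - d * R - d * (\<kappa> * (e k * c k)) - d * (\<kappa> * E)"
    by (simp add: algebra_simps)

  have \<kappa>: "0 \<le> \<kappa>" "\<kappa> \<le> 4"
    using cos_le_one[of I] cos_ge_minus_one[of I] by (auto simp: \<kappa>_def simp del: cos_le_one cos_ge_minus_one)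
  have m: "\<bar>c k\<bar> = d * \<tau> * c k"
  proof -
    have "\<bar>d * \<tau> * c k\<bar> = \<bar>c k\<bar>" using units by (simp add: abs_mult)
    then show ?thesis using phase by (simp add: c_def)
  qed
  have "\<bar>e k\<bar> \<le> large_window ^ 3 / 6"
    using sin_cubic_bound[of "u (Suc k)"] power_mono[OF large abs_ge_zero, of 3]
    unfolding e_def by linarith
  also have "\<dots> \<le> 53/100" by (simp add: eval_nat_numeral)
  finally have ek: "\<bar>e k\<bar> \<le> 53/100" .
  have "\<bar>\<kappa> * (e k * c k)\<bar> \<le> 4 * (53/100 * \<bar>c k\<bar>)"
    using \<kappa> ek unfolding abs_mult by (intro mult_mono) auto
  also have "\<dots> = 212/100 * (d * \<tau> * c k)"
    unfolding m by simp
  finally have P: "\<bar>d * (\<kappa> * (e k * c k))\<bar> \<le> 212/100 * (d * \<tau> * c k)"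
    unfolding abs_mult[of d] units by simp
  have e: "\<bar>e j\<bar> \<le> 474/100000" if "j < 24" "j \<noteq> k" for j
  proof -
    have "\<bar>e j\<bar> \<le> small_window ^ 3 / 6"
      using sin_cubic_bound[of "u (Suc j)"] power_mono[OF small[OF that] abs_ge_zero, of 3]
      unfolding e_def by linarith
    also have "\<dots> \<le> 474/100000" by (simp add: eval_nat_numeral)
    finally show ?thesis .
  qed
  have "\<bar>E\<bar> \<le> (\<Sum>j\<in>{..<24}-{k}. \<bar>e j * c j\<bar>)" unfolding E_def by (rule sum_abs)
  also have "\<dots> \<le> (\<Sum>j\<in>{..<24}-{k}. 474/100000)"
    unfolding c_def by (intro sum_mono bound e) auto
  also have "\<dots> \<le> 11/100" using k by simp
  finally have "\<bar>E\<bar> \<le> 11/100" .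
  then have "\<bar>\<kappa>\<bar> * \<bar>E\<bar> \<le> 4 * (11/100)"
    using \<kappa> by (intro mult_mono) auto
  then have Q: "\<bar>d * (\<kappa> * E)\<bar> \<le> 44/100"
    using units by (simp add: abs_mult)
  have "\<bar>R\<bar> \<le> (\<Sum>j<24. \<bar>(u (Suc (Suc j)) + u j
      - (2 * u (Suc j) + 4 * sin (u (Suc j)) - (if j = k then 2 * pi * \<tau> else 0))) * c j\<bar>)"
    unfolding R_def by (rule sum_abs)
  also have "\<dots> \<le> (\<Sum>j<(24::nat). \<epsilon>)"
    unfolding c_def by (intro sum_mono bound recurrence) auto
  finally have "\<bar>d * R\<bar> \<le> 1/1000" using eps units by (simp add: abs_mult)
  moreover have "\<bar>d * B\<bar> \<le> 122/100"
  proof -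
    have "\<bar>B\<bar> \<le> 122/100"
      using bound[OF ends(1), of \<phi>] bound[OF ends(2), of "\<phi> - I"]
        bound[OF ends(3), of "\<phi> + 24 * I"] bound[OF ends(4), of "\<phi> + 24 * I - I"]
      unfolding B_def by linarith
    then show ?thesis using units by (simp add: abs_mult)
  qed
  moreover have "628/100 * (d * \<tau> * c k) \<le> 2 * pi * (d * \<tau> * c k)"
    using pi_bounds phase by (intro mult_right_mono) (auto simp: c_def)
  moreover have "49/100 \<le> d * \<tau> * c k" using phase by (simp add: c_def)
  \<comment> \<open>The main term is at least \<open>(6.28 - 2.12) * 0.49 > 2.03\<close>; the losses sum to \<open>0.44 + 1.22 + 0.001\<close>.\<close>
  ultimately have "32/100 \<le> (4 + \<kappa>) * (d * X)"
    using id P Q by linarith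
  then have pos: "0 < d * X"
    using \<kappa> zero_less_mult_pos[of "4 + \<kappa>" "d * X"] by linarith
  have "(4 + \<kappa>) * (d * X) \<le> 8 * (d * X)"
    using \<kappa> pos by (intro mult_right_mono) auto
  with \<open>32/100 \<le> (4 + \<kappa>) * (d * X)\<close> have "1/25 \<le> d * X" by linarith
  then show ?thesis by (simp add: X_def c_def)
qed

section \<open>Steering the action\<close>

text \<open>The small window twice, for the current and the previous position: the state from which any schedule
  whose first kick is not immediate can be started.\<close>

definition ready :: "real \<Rightarrow> lift set \<Rightarrow> bool" where
  "ready \<epsilon> \<Gamma> \<longleftrightarrow> unstable_arc \<epsilon> small_window small_window \<Gamma>"

definition reachable :: "real \<Rightarrow> lift \<Rightarrow> lift \<Rightarrow> bool" where
  "reachable \<epsilon> = (\<lambda>S T. \<exists>k. T = lift_step \<epsilon> k S)\<^sup>*\<^sup>*"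

lemma reachable_trajectory: "reachable \<epsilon> S (trajectory \<epsilon> \<sigma> S n)"
  by (induction n) (auto simp: reachable_def intro: rtranclp.rtrancl_into_rtrancl)

lemma ready_close:
  assumes "0 < \<epsilon>" "ready \<epsilon> \<Gamma>" "S \<in> \<Gamma>" "T \<in> \<Gamma>"
  shows "\<bar>angle S - angle T\<bar> \<le> 6 * \<epsilon>" "\<bar>act S - act T\<bar> \<le> 2 * \<epsilon>"
proof -
  have "\<bar>pos S\<bar> \<le> small_window" "\<bar>pos T\<bar> \<le> small_window"
    using assms by (auto simp: ready_def unstable_arc_def)
  then have "\<bar>pos S - pos T\<bar> \<le> 61/100" by linarith
  then have *: "\<epsilon> * \<bar>pos S - pos T\<bar> \<le> \<epsilon> * (61/100)"
    using assms(1) by (intro mult_left_mono) auto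
  have "\<bar>angle S - angle T\<bar> \<le> 9 * \<epsilon> * \<bar>pos S - pos T\<bar>" "\<bar>act S - act T\<bar> \<le> 3 * \<epsilon> * \<bar>pos S - pos T\<bar>"
    using assms by (auto simp: ready_def unstable_arc_def)
  then show "\<bar>angle S - angle T\<bar> \<le> 6 * \<epsilon>" "\<bar>act S - act T\<bar> \<le> 2 * \<epsilon>"
    using * assms(1) unfolding mult.assoc by linarith+
qed

text \<open>One block: a kick at a time \<open>k\<close> between 1 and 22, read off from the arbitrary state \<open>S0\<close> of the arc,
  and no control otherwise. Since \<open>k\<close> is neither the first nor one of the last two positions of
  the block, the resulting arc is ready again. Here 24 also bounds the change of action in units of \<open>\<epsilon>\<close>.\<close>

lemma kick_block:
  assumes eps: "0 < \<epsilon>" "\<epsilon> \<le> 1/1000000"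
    and ready: "ready \<epsilon> \<Gamma>" and S0: "S0 \<in> \<Gamma>" "1/11 \<le> sin (act S0)"
    and d: "\<bar>d\<bar> = (1::real)"
  obtains \<Gamma>' where "ready \<epsilon> \<Gamma>'"
    "\<And>T. T \<in> \<Gamma>' \<Longrightarrow> \<exists>S\<in>\<Gamma>. reachable \<epsilon> S T \<and> \<epsilon> / 50 \<le> d * (act T - act S) \<and> \<bar>act T - act S\<bar> \<le> 24 * \<epsilon>"
proof -
  obtain k :: nat where k: "1 \<le> k" "k \<le> 22" "1/2 \<le> \<bar>cos (angle S0 + k * act S0)\<bar>"
    using favourable_phase[OF S0(2)] by (metis atLeastAtMost_iff)
  \<comment> \<open>The sign for which the kick pushes the action in the direction \<open>d\<close>.\<close>
  define \<tau> :: int where "\<tau> = (if 0 \<le> d * cos (angle S0 + k * act S0) then 1 else -1)"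
  define \<sigma> where "\<sigma> = (\<lambda>i. if i = k then \<tau> else 0)"
  define r where "r = (\<lambda>i. if i = k then large_window else small_window)"
  have \<tau>1: "\<bar>real_of_int \<tau>\<bar> = 1" by (simp add: \<tau>_def)
  have \<tau>: "1/2 \<le> d * \<tau> * cos (angle S0 + k * act S0)"
  proof -
    have "d * \<tau> * cos (angle S0 + k * act S0) = \<bar>d * cos (angle S0 + k * act S0)\<bar>"
      by (simp add: \<tau>_def)
    then show ?thesis using k(3) d by (simp add: abs_mult)
  qed
  have cover: "(if i = 0 then small_window else r (i - 1)) + r (Suc i) + 2 * pi * \<bar>of_int (\<sigma> i)\<bar> + \<epsilon>
        \<le> 2 * r i + 4 * sin (r i)" for i
  proof (cases "i = k")
    case True
    then have vals: "(if i = 0 then small_window else r (i - 1)) = small_window" "r (Suc i) = small_window"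
      "r i = large_window" "\<bar>of_int (\<sigma> i)\<bar> = (1::real)"
      using k \<tau>1 by (auto simp: r_def \<sigma>_def)
    show ?thesis
      unfolding vals using sin_large_window pi_bounds eps by linarith
  next
    case False
    then have "(if i = 0 then small_window else r (i - 1)) + r (Suc i) \<le> small_window + large_window"
      by (auto simp: r_def)
    moreover have vals: "r i = small_window" "of_int (\<sigma> i) = (0::real)"
      using False by (auto simp: r_def \<sigma>_def)
    ultimately show ?thesis
      unfolding vals abs_zero mult_zero_right using sin_small_window eps by linarith
  qed
  define \<Gamma>' where "\<Gamma>' = survivors \<epsilon> \<sigma> r \<Gamma> 24"
  show thesis
  proof (rule that[of \<Gamma>'])
    have "unstable_arc \<epsilon> (if (24::nat) = 0 then small_window else r (24 - 1)) (r 24) (survivors \<epsilon> \<sigma> r \<Gamma> 24)"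
    proof (rule unstable_arc_survivors)
      show "unstable_arc \<epsilon> small_window (r 0) \<Gamma>" using ready k by (simp add: ready_def r_def)
    qed (use eps cover in \<open>auto simp: r_def\<close>)
    then show "ready \<epsilon> \<Gamma>'"
      using k by (simp add: ready_def r_def \<Gamma>'_def)
  next
    fix T assume "T \<in> \<Gamma>'"
    then obtain S where S: "S \<in> \<Gamma>" and T: "T = trajectory \<epsilon> \<sigma> S 24"
      and win: "\<And>i. i \<le> 24 \<Longrightarrow> \<bar>pos (trajectory \<epsilon> \<sigma> S i)\<bar> \<le> r i"
      by (auto simp: \<Gamma>'_def survivors_def)
    let ?T = "trajectory \<epsilon> \<sigma> S"
    define \<phi> where "\<phi> = angle S"
    define J where "J = act S"
    \<comment> \<open>Shifted by one, so that the previous position of the initial state is included.\<close>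
    define u where "u = (\<lambda>j. case j of 0 \<Rightarrow> prev S | Suc i \<Rightarrow> pos (?T i))"
    have u_Suc: "u (Suc i) = pos (?T i)" for i by (simp add: u_def)
    have u_prev: "u i = prev (?T i)" for i by (cases i) (simp_all add: u_def)
    have recurrence: "\<bar>u (Suc (Suc j)) + u j - (2 * u (Suc j) + 4 * sin (u (Suc j)) - (if j = k then 2 * pi * \<tau> else 0))\<bar> \<le> \<epsilon>" for j
    proof -
      have "\<bar>cos (pos (?T j))\<bar> * \<bar>sin (angle (?T j))\<bar> \<le> 1 * 1" by (intro mult_mono) auto
      then have "\<bar>\<epsilon> * (cos (pos (?T j)) * sin (angle (?T j)))\<bar> \<le> \<epsilon>"
        using eps mult_left_mono[of "\<bar>cos (pos (?T j))\<bar> * \<bar>sin (angle (?T j))\<bar>" 1 \<epsilon>] by (simp add: abs_mult)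
      then show ?thesis
        unfolding u_Suc u_prev[of j] by (auto simp: \<sigma>_def)
    qed
    have phase: "49/100 \<le> d * \<tau> * cos (\<phi> + k * J)"
    proof -
      have "\<bar>cos (angle S0 + k * act S0) - cos (\<phi> + k * J)\<bar>
          \<le> \<bar>(angle S0 - \<phi>) + k * (act S0 - J)\<bar>"
        using cos_lipschitz[of "angle S0 + k * act S0" "\<phi> + k * J"] by (simp add: algebra_simps)
      also have "\<dots> \<le> \<bar>angle S0 - \<phi>\<bar> + k * \<bar>act S0 - J\<bar>"
        by (metis abs_mult abs_of_nat abs_triangle_ineq)
      also have "\<dots> \<le> 6 * \<epsilon> + 22 * (2 * \<epsilon>)"
        using ready_close[OF eps(1) ready S0(1) S] k(2) unfolding \<phi>_def J_def
        by (intro add_mono mult_mono) auto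
      also have "\<dots> \<le> 1/100" using eps by simp
      finally have "\<bar>d * \<tau> * (cos (angle S0 + k * act S0) - cos (\<phi> + k * J))\<bar> \<le> 1/100"
        using d \<tau>1 by (simp add: abs_mult)
      then show ?thesis using \<tau> unfolding right_diff_distrib by linarith
    qed
    have gain: "1/25 \<le> d * (\<Sum>j<24. sin (u (Suc j)) * cos (\<phi> + j * J))"
    proof (rule kick_gain[OF eps(2)])
      show "\<bar>u 0\<bar> \<le> small_window" using ready S by (auto simp: u_def ready_def unstable_arc_def)
      show "\<bar>u 1\<bar> \<le> small_window" using win[of 0] k u_Suc[of 0] by (simp add: r_def)
      show "\<bar>u 24\<bar> \<le> small_window" using win[of 23] k u_Suc[of 23] by (simp add: r_def del: trajectory.simps)
      show "\<bar>u (Suc 24)\<bar> \<le> small_window" using win[of 24] k u_Suc[of 24] by (simp add: r_def)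
      show "k < 24" using k by simp
      show "\<bar>u (Suc k)\<bar> \<le> large_window" using win[of k] k by (simp add: u_Suc r_def)
      show "\<bar>u (Suc j)\<bar> \<le> small_window" if "j < 24" "j \<noteq> k" for j
        using win[of j] that by (simp add: u_Suc r_def)
    qed (use recurrence d \<tau>1 phase in auto)
    define X where "X = (\<Sum>j<24. sin (pos (?T j)) * cos (angle (?T j)))"
    define Y where "Y = (\<Sum>j<24. sin (u (Suc j)) * cos (\<phi> + j * J))"
    have "\<bar>X - Y\<bar> \<le> (\<Sum>j<24. \<bar>sin (pos (?T j)) * (cos (angle (?T j)) - cos (\<phi> + j * J))\<bar>)"
      unfolding X_def Y_def sum_subtractf[symmetric] u_Suc right_diff_distrib[symmetric] by (rule sum_abs)
    also have "\<dots> \<le> (\<Sum>j<(24::nat). 1 * (\<epsilon> * 24\<^sup>2))"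
    proof (rule sum_mono)
      fix j :: nat assume "j \<in> {..<24}"
      then have "(real j)\<^sup>2 \<le> 24\<^sup>2" by (intro power_mono) auto
      then have "\<epsilon> * (real j)\<^sup>2 \<le> \<epsilon> * 24\<^sup>2" using eps by (intro mult_left_mono) auto
      moreover have "\<bar>cos (angle (?T j)) - cos (\<phi> + j * J)\<bar> \<le> \<epsilon> * (real j)\<^sup>2"
        using trajectory_drift(2)[of \<epsilon> \<sigma> S j] cos_lipschitz[of "angle (?T j)" "\<phi> + j * J"] eps
        by (simp add: \<phi>_def J_def)
      ultimately show "\<bar>sin (pos (?T j)) * (cos (angle (?T j)) - cos (\<phi> + j * J))\<bar> \<le> 1 * (\<epsilon> * 24\<^sup>2)"
        unfolding abs_mult by (intro mult_mono) auto
    qed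
    also have "\<dots> \<le> 1/50" using eps by simp
    finally have "\<bar>d * (X - Y)\<bar> \<le> 1/50" using d by (simp add: abs_mult)
    then have "1/50 \<le> d * X"
      using gain unfolding Y_def[symmetric] right_diff_distrib by linarith
    then have "\<epsilon> * (1/50) \<le> \<epsilon> * (d * X)" using eps by (intro mult_left_mono) auto
    moreover have "act T - act S = \<epsilon> * X"
      unfolding T X_def by (simp add: act_trajectory)
    ultimately have "\<epsilon> / 50 \<le> d * (act T - act S)" by (simp add: mult.left_commute)
    moreover have "\<bar>act T - act S\<bar> \<le> 24 * \<epsilon>"
      using trajectory_drift(1)[of \<epsilon> \<sigma> S 24] eps unfolding T by simp
    moreover have "reachable \<epsilon> S T" unfolding T by (rule reachable_trajectory)
    ultimately show "\<exists>S\<in>\<Gamma>. reachable \<epsilon> S T \<and> \<epsilon> / 50 \<le> d * (act T - act S) \<and> \<bar>act T - act S\<bar> \<le> 24 * \<epsilon>"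
      using S by blast
  qed
qed


lemma sin_ge_one_eleventh:
  assumes "92/1000 \<le> x" "x \<le> pi - 92/1000"
  shows "1/11 \<le> sin x"
proof -
  have "\<bar>92/1000 :: real\<bar>^3 / 6 \<le> 2/10000" by (simp add: eval_nat_numeral)
  then have *: "1/11 \<le> sin (92/1000 :: real)"
    using sin_cubic_bound[of "92/1000"] by linarith
  have "sin (92/1000) \<le> sin y" if "92/1000 \<le> y" "y \<le> pi/2" for y :: real
    using that pi_gt3 by (intro sin_monotone_2pi_le) auto
  from this[of x] this[of "pi - x"] * show ?thesis
    using assms by (cases "x \<le> pi/2") (auto simp del: sin_pi_minus simp: sin_pi_minus[symmetric, of x])
qed

text \<open>Blocks in the direction \<open>d\<close> are repeated until some state of the arc comes within \<open>24 \<epsilon>\<close> of the target or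
  passes it. Progress is measured by a bound valid on the whole arc, which drops by \<open>\<epsilon>/50\<close> in each block. The value of a
  single reference state would not do, as a change of reference may cost \<open>2 \<epsilon>\<close>, far more than a block gains.\<close>

lemma directed_transport:
  fixes n :: nat
  assumes eps: "0 < \<epsilon>" "\<epsilon> \<le> 1/1000000"
    and d: "\<bar>d\<bar> = (1::real)"
    and J: "1/5 \<le> J" "J \<le> pi - 1/10"
    and ready: "ready \<epsilon> \<Gamma>"
    and range: "\<And>S. S \<in> \<Gamma> \<Longrightarrow> 1/5 - 30 * \<epsilon> \<le> act S \<and> act S \<le> pi - 1/10 + 30 * \<epsilon>"
    and behind: "\<And>S. S \<in> \<Gamma> \<Longrightarrow> - (30 * \<epsilon>) \<le> d * (J - act S) \<and> d * (J - act S) \<le> n * (\<epsilon> / 50)"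
  shows "\<exists>\<Gamma>'. ready \<epsilon> \<Gamma>' \<and>
      (\<forall>T\<in>\<Gamma>'. \<bar>act T - J\<bar> \<le> 30 * \<epsilon> \<and> (\<exists>S\<in>\<Gamma>. reachable \<epsilon> S T))"
  using ready range behind
proof (induction n arbitrary: \<Gamma>)
  case (0 \<Gamma>)
  then have "\<forall>T\<in>\<Gamma>. \<bar>d * (J - act T)\<bar> \<le> 30 * \<epsilon>" using eps by (fastforce simp: abs_le_iff)
  then have "\<forall>T\<in>\<Gamma>. \<bar>act T - J\<bar> \<le> 30 * \<epsilon>" using d by (simp add: abs_mult abs_minus_commute)
  then show ?case
    using 0 by (intro exI[of _ \<Gamma>]) (auto simp: reachable_def)
next
  case (Suc n \<Gamma>)
  obtain S0 where S0: "S0 \<in> \<Gamma>"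
    using Suc.prems(1) by (force simp: ready_def unstable_arc_def)
  have close: "\<bar>d * (J - act S) - d * (J - act S0)\<bar> \<le> 2 * \<epsilon>" if "S \<in> \<Gamma>" for S
  proof -
    have "d * (J - act S) - d * (J - act S0) = d * (act S0 - act S)" by (simp add: algebra_simps)
    then show ?thesis
      using ready_close(2)[OF eps(1) Suc.prems(1) S0 that] d by (simp add: abs_mult)
  qed
  show ?case
  proof (cases "d * (J - act S0) \<le> 24 * \<epsilon>")
    case True
    have "\<bar>act T - J\<bar> \<le> 30 * \<epsilon>" if "T \<in> \<Gamma>" for T
    proof -
      have "\<bar>d * (J - act T)\<bar> \<le> 30 * \<epsilon>"
        using close[OF that] Suc.prems(3)[OF that] True eps by linarith
      then show ?thesis using d by (simp add: abs_mult abs_minus_commute)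
    qed
    then show ?thesis
      using Suc.prems by (intro exI[of _ \<Gamma>]) (auto simp: reachable_def)
  next
    case False
    \<comment> \<open>The action stays in a neighbourhood of \<open>[1/5, \<pi> - 1/10]\<close>, so \<open>favourable_phase\<close> remains applicable.\<close>
    have "1/11 \<le> sin (act S0)"
      using Suc.prems(2)[OF S0] eps by (intro sin_ge_one_eleventh) auto
    from kick_block[OF eps Suc.prems(1) S0 this d] obtain \<Gamma>' where \<Gamma>': "ready \<epsilon> \<Gamma>'"
      and step: "\<And>T. T \<in> \<Gamma>' \<Longrightarrow> \<exists>S\<in>\<Gamma>. reachable \<epsilon> S T \<and> \<epsilon> / 50 \<le> d * (act T - act S)
        \<and> \<bar>act T - act S\<bar> \<le> 24 * \<epsilon>" by metis
    have "\<exists>\<Gamma>''. ready \<epsilon> \<Gamma>'' \<and>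
      (\<forall>T\<in>\<Gamma>''. \<bar>act T - J\<bar> \<le> 30 * \<epsilon> \<and> (\<exists>S\<in>\<Gamma>'. reachable \<epsilon> S T))"
    proof (rule Suc.IH[OF \<Gamma>'])
      fix T assume "T \<in> \<Gamma>'"
      then obtain S where S: "S \<in> \<Gamma>" "\<epsilon> / 50 \<le> d * (act T - act S)" "\<bar>act T - act S\<bar> \<le> 24 * \<epsilon>"
        using step by blast
      have split: "d * (J - act T) = d * (J - act S) - d * (act T - act S)" by (simp add: algebra_simps)
      have "d * (act T - act S) \<le> 24 * \<epsilon>"
        using S(3) d abs_ge_self[of "d * (act T - act S)"] by (simp add: abs_mult)
      then show behind': "- (30 * \<epsilon>) \<le> d * (J - act T) \<and> d * (J - act T) \<le> n * (\<epsilon> / 50)"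
        using close[OF S(1)] False S(2) Suc.prems(3)[OF S(1)] eps unfolding split
        by (auto simp: algebra_simps)
      from d have "d = 1 \<or> d = -1" by auto
      then show "1/5 - 30 * \<epsilon> \<le> act T \<and> act T \<le> pi - 1/10 + 30 * \<epsilon>"
        using Suc.prems(2)[OF S(1)] S(2) behind' J eps by auto
    qed
    then show ?thesis
      using step unfolding reachable_def by (meson rtranclp_trans)
  qed
qed

lemma transport_to_action:
  assumes eps: "0 < \<epsilon>" "\<epsilon> \<le> 1/1000000"
    and J: "1/5 \<le> J" "J \<le> pi - 1/10"
    and ready: "ready \<epsilon> \<Gamma>"
    and range: "\<And>S. S \<in> \<Gamma> \<Longrightarrow> 1/5 - 30 * \<epsilon> \<le> act S \<and> act S \<le> pi - 1/10 + 30 * \<epsilon>"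
  shows "\<exists>\<Gamma>'. ready \<epsilon> \<Gamma>' \<and>
      (\<forall>T\<in>\<Gamma>'. \<bar>act T - J\<bar> \<le> 30 * \<epsilon> \<and> (\<exists>S\<in>\<Gamma>. reachable \<epsilon> S T))"
proof -
  obtain S0 where S0: "S0 \<in> \<Gamma>"
    using ready by (force simp: ready_def unstable_arc_def)
  define d :: real where "d = (if act S0 \<le> J then 1 else -1)"
  obtain n :: nat where "5 / (\<epsilon> / 50) \<le> n" using real_arch_simple by blast
  then have n: "5 \<le> n * (\<epsilon> / 50)" using eps by (simp add: pos_divide_le_eq)
  show ?thesis
  proof (rule directed_transport[OF eps _ J ready range])
    show "\<bar>d\<bar> = 1" by (simp add: d_def)
    fix S assume S: "S \<in> \<Gamma>"
    have "\<bar>act S0 - act S\<bar> \<le> 2 * \<epsilon>" using ready_close(2)[OF eps(1) ready S0 S] .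
    moreover have "\<bar>J - act S\<bar> \<le> 5"
      using range[OF S] J eps pi_less_4 by (simp add: abs_le_iff)
    ultimately show "- (30 * \<epsilon>) \<le> d * (J - act S) \<and> d * (J - act S) \<le> n * (\<epsilon> / 50)"
      using n eps by (auto simp: d_def abs_le_iff)
  qed
qed

lemma lifts_to_reachable:
  assumes "reachable \<epsilon> S T" "lifts_to z S"
  shows "\<exists>n. lifts_to ((gen_std_map 4 \<epsilon> ^^ n) z) T"
  using assms unfolding reachable_def
proof (induction rule: rtranclp_induct)
  case base
  then show ?case by (intro exI[of _ 0]) simp
next
  case (step T U)
  then obtain n where "lifts_to ((gen_std_map 4 \<epsilon> ^^ n) z) T" by blast
  then have "lifts_to ((gen_std_map 4 \<epsilon> ^^ Suc n) z) U"
    using step.hyps(2) lifts_to_step by (metis comp_apply funpow.simps(2))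
  then show ?case by blast
qed

lemma circle_abs_action:
  assumes "lifts_to z T" "\<bar>act T - J\<bar> \<le> 3"
  shows "circle_abs (action z - to_circle J) = \<bar>act T - J\<bar>"
proof -
  have "action z - to_circle J = to_circle (act T - J)"
    using assms(1) by (auto simp: lifts_to_def minus_circle.abs_eq)
  then show ?thesis
    using assms(2) pi_gt3 by (simp add: circle_abs_to_circle)
qed

section \<open>Visiting a sequence of actions\<close>

definition itinerary :: "real \<Rightarrow> (nat \<Rightarrow> real) \<Rightarrow> nat \<Rightarrow> (nat \<Rightarrow> int) \<Rightarrow> (nat \<Rightarrow> phase) \<Rightarrow> bool" where
  "itinerary \<epsilon> I L n z \<longleftrightarrow>
     (\<forall>l\<in>{1..L}. z l = int_iterate (gen_std_map 4 \<epsilon>) (n l) (z (l - 1))) \<and>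
     (\<forall>l\<le>L. circle_abs (action (z l) - to_circle (I l)) < \<epsilon> * 40)"

text \<open>The statement is about all states of a whole arc, each with its own past. The induction can therefore
  extend the arc freely: cutting it to later windows discards states but keeps their pasts valid.\<close>

lemma itinerary_exists:
  assumes eps: "0 < \<epsilon>" "\<epsilon> \<le> 1/1000000"
    and I: "\<And>l. l \<le> L \<Longrightarrow> I l \<in> {1/5 .. pi - 1/10}"
  shows "\<exists>\<Gamma>. ready \<epsilon> \<Gamma> \<and> (\<forall>T\<in>\<Gamma>. \<bar>act T - I L\<bar> \<le> 30 * \<epsilon> \<and>
      (\<exists>n z. lifts_to (z L) T \<and> itinerary \<epsilon> I L n z))"
  using I
proof (induction L)
  case 0
  define \<Gamma> where "\<Gamma> = (\<lambda>b. Lift 0 b 0 (I 0)) ` {- small_window .. small_window}"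
  have "ready \<epsilon> \<Gamma>"
    using eps by (auto simp: ready_def unstable_arc_def \<Gamma>_def)
  moreover have "\<bar>act T - I 0\<bar> \<le> 30 * \<epsilon> \<and> (\<exists>n z. lifts_to (z 0) T \<and> itinerary \<epsilon> I 0 n z)"
    if T_in: "T \<in> \<Gamma>" for T
  proof -
    obtain b where T: "T = Lift 0 b 0 (I 0)" using T_in by (auto simp: \<Gamma>_def)
    define z :: phase where "z = (b, b, to_circle 0, to_circle (I 0))"
    have z: "lifts_to z T"
      unfolding lifts_to_def z_def T by (intro exI[of _ "0::int"]) simp
    then have "itinerary \<epsilon> I 0 (\<lambda>_. 0) (\<lambda>_. z)"
      using eps circle_abs_action[OF z, of "I 0"] by (simp add: itinerary_def T)
    with z have "\<exists>n z. lifts_to (z 0) T \<and> itinerary \<epsilon> I 0 n z"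
      by (intro exI[of _ "\<lambda>_. 0"] exI[of _ "\<lambda>_. z"]) simp
    then show ?thesis using eps T by simp
  qed
  ultimately show ?case by blast
next
  case (Suc L)
  then obtain \<Gamma> where \<Gamma>: "ready \<epsilon> \<Gamma>"
    and near: "\<And>S. S \<in> \<Gamma> \<Longrightarrow> \<bar>act S - I L\<bar> \<le> 30 * \<epsilon>"
    and orbit: "\<And>S. S \<in> \<Gamma> \<Longrightarrow> \<exists>n z. lifts_to (z L) S \<and> itinerary \<epsilon> I L n z"
    by (metis le_SucI)
  have "1/5 - 30 * \<epsilon> \<le> act S \<and> act S \<le> pi - 1/10 + 30 * \<epsilon>" if "S \<in> \<Gamma>" for S
    using near[OF that] Suc.prems[of L] by (auto simp: abs_le_iff)
  then obtain \<Gamma>' where \<Gamma>': "ready \<epsilon> \<Gamma>'"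
    and near': "\<And>T. T \<in> \<Gamma>' \<Longrightarrow> \<bar>act T - I (Suc L)\<bar> \<le> 30 * \<epsilon>"
    and reach: "\<And>T. T \<in> \<Gamma>' \<Longrightarrow> \<exists>S\<in>\<Gamma>. reachable \<epsilon> S T"
    using transport_to_action[OF eps _ _ \<Gamma>, of "I (Suc L)"] Suc.prems[of "Suc L"] by auto
  have "\<exists>n z. lifts_to (z (Suc L)) T \<and> itinerary \<epsilon> I (Suc L) n z" if T: "T \<in> \<Gamma>'" for T
  proof -
    obtain S where S: "S \<in> \<Gamma>" "reachable \<epsilon> S T" using reach[OF T] by blast
    obtain n z where z: "lifts_to (z L) S" "itinerary \<epsilon> I L n z" using orbit[OF S(1)] by blast
    obtain m where m: "lifts_to ((gen_std_map 4 \<epsilon> ^^ m) (z L)) T"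
      using lifts_to_reachable[OF S(2) z(1)] by blast
    define n' where "n' = n(Suc L := int m)"
    define z' where "z' = z(Suc L := (gen_std_map 4 \<epsilon> ^^ m) (z L))"
    have "itinerary \<epsilon> I (Suc L) n' z'"
      unfolding itinerary_def
    proof (intro conjI ballI allI impI)
      fix l assume l: "l \<in> {1..Suc L}"
      show "z' l = int_iterate (gen_std_map 4 \<epsilon>) (n' l) (z' (l - 1))"
      proof (cases "l = Suc L")
        case True
        then show ?thesis by (simp add: n'_def z'_def int_iterate_def)
      next
        case False
        then have "l \<in> {1..L}" "l - 1 \<noteq> Suc L" using l by auto
        then show ?thesis using z(2) False by (simp add: itinerary_def n'_def z'_def)
      qed
    next
      fix l assume l: "l \<le> Suc L"
      show "circle_abs (action (z' l) - to_circle (I l)) < \<epsilon> * 40"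
      proof (cases "l = Suc L")
        case True
        then show ?thesis
          using circle_abs_action[OF m, of "I (Suc L)"] near'[OF T] eps by (simp add: z'_def)
      next
        case False
        then show ?thesis using z(2) l by (simp add: itinerary_def z'_def)
      qed
    qed
    moreover have "lifts_to (z' (Suc L)) T" using m by (simp add: z'_def)
    ultimately show ?thesis by blast
  qed
  then show ?case using \<Gamma>' near' by blast
qed

theorem theorem25:
  shows "\<exists>M>0. \<forall>(L::nat) (I::nat \<Rightarrow> real).
    (\<forall>l\<le>L. I l \<in> {1/5 .. pi - 1/10}) \<longrightarrow>
    (\<forall>\<^sub>F \<epsilon> in at_right 0. \<exists>(n::nat \<Rightarrow> int) (z::nat \<Rightarrow> phase).
      (\<forall>l\<in>{1..L}. z l = int_iterate (gen_std_map 4 \<epsilon>) (n l) (z (l - 1))) \<and>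
      (\<forall>l\<le>L. circle_abs (action (z l) - to_circle (I l)) < \<epsilon> * M))"
proof (intro exI[of _ 40] conjI allI impI)
  fix L :: nat and I :: "nat \<Rightarrow> real"
  assume I: "\<forall>l\<le>L. I l \<in> {1/5 .. pi - 1/10}"
  have "\<exists>n z. itinerary \<epsilon> I L n z" if "0 < \<epsilon>" "\<epsilon> < 1/1000000" for \<epsilon>
  proof -
    obtain \<Gamma> where "ready \<epsilon> \<Gamma>" "\<forall>T\<in>\<Gamma>. \<exists>n z. itinerary \<epsilon> I L n z"
      using itinerary_exists[of \<epsilon> L I] \<open>0 < \<epsilon>\<close> \<open>\<epsilon> < 1/1000000\<close> I by (meson less_imp_le)
    moreover from this obtain T where "T \<in> \<Gamma>" by (force simp: ready_def unstable_arc_def)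
    ultimately show ?thesis by blast
  qed
  then have "\<forall>\<^sub>F \<epsilon> in at_right 0. \<exists>n z. itinerary \<epsilon> I L n z"
    by (intro eventually_at_rightI[of 0 "1/1000000"]) auto
  then show "\<forall>\<^sub>F \<epsilon> in at_right 0. \<exists>n z.
      (\<forall>l\<in>{1..L}. z l = int_iterate (gen_std_map 4 \<epsilon>) (n l) (z (l - 1))) \<and>
      (\<forall>l\<le>L. circle_abs (action (z l) - to_circle (I l)) < \<epsilon> * 40)"
    by (simp add: itinerary_def)
qed simp

end
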